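(* Let $T>0$, $\gamma\in\left(\frac13,\frac12\right]$, $\kappa\in(0,1)$ with $\kappa+\gamma>1$, $a\in\mathbb{R}$, and let $x:[0,T]\to\mathbb{R}$ be $\gamma$-Hölder continuous with $x_0=0$. Let $\sigma:\mathbb{R}\to\mathbb{R}$ be positive on $(0,\infty)$, and assume that $\phi(\xi)=\int_0^{\xi}\frac{ds}{\sigma(s)}$ exists for $\xi\in\mathbb{R}$ (with inverse $\phi^{-1}$ defined on $\mathbb{R}$) and that the function $F=(D\sigma\cdot\sigma)\circ\phi^{-1}$ satisfies, for some constant $C$ and all $\xi_1,\xi_2\in\mathbb{R}$, $$|F(\xi_1)-F(\xi_2)|\le C\left||\xi_1|^{\frac{2\kappa-1}{1-\kappa}\wedge1}-|\xi_2|^{\frac{2\kappa-1}{1-\kappa}\wedge1}\right|.$$ Then the function $y=\phi^{-1}(x+\phi(a))$ is a solution of the equation $$y_t=a+\int_0^t\sigma(y_s)\,dx_s,\qquad t\in[0,T],$$ where the integral is a rough integral with respect to $x$.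
   Context: Here $D\sigma$ denotes the derivative of $\sigma$; $\sigma$ is continuous, continuously differentiable away from $0$, and $D\sigma\cdot\sigma$ is understood as extended by continuity at $0$. For a path $f$ write $\delta f_{st}=f_t-f_s$. In dimension one, $x$ is lifted to a rough path by $\mathbf{x}^2_{st}=\frac12(\delta x_{st})^2$. Controlled processes: for $\eta>\gamma$, a $\gamma$-Hölder path $m:[0,T]\to\mathbb{R}$ is weakly controlled by $x$ with a remainder of order $\eta$ if $\delta m_{st}=\mu_s\,\delta x_{st}+r_{st}$ for all $0\le s\le t\le T$, where $\mu$ is a bounded $(\eta-\gamma)$-Hölder path and $\sup_{s<t}|r_{st}|/|t-s|^{\eta}<\infty$. Rough integral: if moreover $\eta+\gamma>1$, $$\int_s^t m_u\,dx_u=\lim_{|\Pi_{st}|\to0}\sum_{q=0}^{n-1}\left[m_{t_q}\delta x_{t_qt_{q+1}}+\mu_{t_q}\mathbf{x}^2_{t_qt_{q+1}}\right],$$ the limit being over partitions $\Pi_{st}=\{s=t_0<\dots<t_n=t\}$ of $[s,t]$ with mesh going to zero. In the equation, $m=\sigma(y)$ is taken with derivative $\mu=(D\sigma\cdot\sigma)(y)$. *)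

theory Defs
  imports "HOL-Analysis.Analysis"
begin

definition holder_on :: "real \<Rightarrow> real set \<Rightarrow> (real \<Rightarrow> real) \<Rightarrow> bool" where
  "holder_on \<gamma> D f \<longleftrightarrow> (\<exists>K. \<forall>s\<in>D. \<forall>t\<in>D. \<bar>f t - f s\<bar> \<le> K * \<bar>t - s\<bar> powr \<gamma>)"

definition weakly_controlled ::
  "real \<Rightarrow> real \<Rightarrow> real \<Rightarrow> (real \<Rightarrow> real) \<Rightarrow> (real \<Rightarrow> real) \<Rightarrow> (real \<Rightarrow> real) \<Rightarrow> bool" where
  "weakly_controlled T \<gamma> \<eta> x m \<mu> \<longleftrightarrow>
     \<gamma> < \<eta> \<and> holder_on \<gamma> {0..T} m \<and>
     bounded (\<mu> ` {0..T}) \<and> holder_on (\<eta> - \<gamma>) {0..T} \<mu> \<and>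
     (\<exists>r :: real \<Rightarrow> real \<Rightarrow> real.
        (\<forall>s t. 0 \<le> s \<and> s \<le> t \<and> t \<le> T \<longrightarrow> m t - m s = \<mu> s * (x t - x s) + r s t) \<and>
        bdd_above {\<bar>r s t\<bar> / \<bar>t - s\<bar> powr \<eta> | s t. 0 \<le> s \<and> s < t \<and> t \<le> T})"

definition rough_lift :: "(real \<Rightarrow> real) \<Rightarrow> real \<Rightarrow> real \<Rightarrow> real" where
  "rough_lift x s t = (x t - x s)\<^sup>2 / 2"

(* A partition s = p 0 < ... < p n = t is the pair (n, p); the values of p beyond n are irrelevant.
   For s = t the only partition is n = 0. *)
definition interval_partition :: "real \<Rightarrow> real \<Rightarrow> nat \<times> (nat \<Rightarrow> real) \<Rightarrow> bool" where
  "interval_partition s t = (\<lambda>(n, p). p 0 = s \<and> p n = t \<and> (\<forall>q<n. p q < p (Suc q)))"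

definition mesh_less :: "real \<Rightarrow> nat \<times> (nat \<Rightarrow> real) \<Rightarrow> bool" where
  "mesh_less d = (\<lambda>(n, p). \<forall>q<n. p (Suc q) - p q < d)"

(* The filter of partitions of [s, t] with mesh tending to 0. *)
definition mesh_filter :: "real \<Rightarrow> real \<Rightarrow> (nat \<times> (nat \<Rightarrow> real)) filter" where
  "mesh_filter s t = (INF d\<in>{0<..}. principal {P. interval_partition s t P \<and> mesh_less d P})"

definition rough_sum ::
  "(real \<Rightarrow> real) \<Rightarrow> (real \<Rightarrow> real) \<Rightarrow> (real \<Rightarrow> real) \<Rightarrow> nat \<times> (nat \<Rightarrow> real) \<Rightarrow> real" where
  "rough_sum x m \<mu> = (\<lambda>(n, p).
     \<Sum>q<n. m (p q) * (x (p (Suc q)) - x (p q)) + \<mu> (p q) * rough_lift x (p q) (p (Suc q)))"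

definition has_rough_integral ::
  "(real \<Rightarrow> real) \<Rightarrow> (real \<Rightarrow> real) \<Rightarrow> (real \<Rightarrow> real) \<Rightarrow> real \<Rightarrow> real \<Rightarrow> real \<Rightarrow> bool" where
  "has_rough_integral x m \<mu> s t I \<longleftrightarrow> (rough_sum x m \<mu> \<longlongrightarrow> I) (mesh_filter s t)"

(* D\<sigma> \<cdot> \<sigma>, extended by continuity at 0. *)
definition Dsigma_sigma :: "(real \<Rightarrow> real) \<Rightarrow> real \<Rightarrow> real" where
  "Dsigma_sigma \<sigma> \<xi> =
     (if \<xi> = 0 then Lim (at 0) (\<lambda>u. deriv \<sigma> u * \<sigma> u) else deriv \<sigma> \<xi> * \<sigma> \<xi>)"

(* The interval integral is signed, so this is also the right value for \<xi> < 0; a zero of \<sigma> at 0,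
   where Isabelle has 1 / 0 = 0, does not affect it. *)
definition phi :: "(real \<Rightarrow> real) \<Rightarrow> real \<Rightarrow> real" where
  "phi \<sigma> \<xi> = (LBINT s=0..\<xi>. 1 / \<sigma> s)"

(* y t = a + \<integral>_0^t \<sigma>(y) dx on [0, T], including that the rough integral is meaningful:
   \<sigma>(y) is weakly controlled by x with derivative (D\<sigma> \<cdot> \<sigma>)(y) and a remainder of some
   order \<eta> > 1 - \<gamma>. *)
definition solves_rde ::
  "real \<Rightarrow> real \<Rightarrow> (real \<Rightarrow> real) \<Rightarrow> (real \<Rightarrow> real) \<Rightarrow> real \<Rightarrow> (real \<Rightarrow> real) \<Rightarrow> bool" where
  "solves_rde T \<gamma> x \<sigma> a y \<longleftrightarrow>
     (\<exists>\<eta>. \<eta> + \<gamma> > 1 \<and>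
        weakly_controlled T \<gamma> \<eta> x (\<lambda>s. \<sigma> (y s)) (\<lambda>s. Dsigma_sigma \<sigma> (y s))) \<and>
     (\<forall>t\<in>{0..T}. \<exists>I.
        has_rough_integral x (\<lambda>s. \<sigma> (y s)) (\<lambda>s. Dsigma_sigma \<sigma> (y s)) 0 t I \<and> y t = a + I)"

lemma eventually_mesh_filter:
  "eventually Q (mesh_filter s t) \<longleftrightarrow>
     (\<exists>d>0. \<forall>P. interval_partition s t P \<and> mesh_less d P \<longrightarrow> Q P)"
proof -
  have "eventually Q (mesh_filter s t) \<longleftrightarrow>
    (\<exists>d\<in>{0<..}. eventually Q (principal {P. interval_partition s t P \<and> mesh_less d P}))"
    unfolding mesh_filter_def
  proof (rule eventually_INF_base)
    fix c d :: real assume cd: "c \<in> {0<..}" "d \<in> {0<..}"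
    show "\<exists>e\<in>{0<..}. principal {P. interval_partition s t P \<and> mesh_less e P}
      \<le> inf (principal {P. interval_partition s t P \<and> mesh_less c P})
          (principal {P. interval_partition s t P \<and> mesh_less d P})"
      using cd by (intro bexI[of _ "min c d"]) (auto simp: mesh_less_def)
  qed auto
  then show ?thesis by (auto simp: eventually_principal)
qed

lemma mesh_filter_not_bot:
  assumes "s \<le> t" shows "mesh_filter s t \<noteq> bot"
proof (cases "s = t")
  case True
  then have "interval_partition s t (0, \<lambda>_. s) \<and> mesh_less d (0, \<lambda>_. s)" for d
    by (auto simp: interval_partition_def mesh_less_def)
  then show ?thesis by (auto simp: trivial_limit_def eventually_mesh_filter)
next
  case False
  with assms have st: "s < t" by simp
  have "\<exists>P. interval_partition s t P \<and> mesh_less d P" if "d > 0" for d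
  proof -
    obtain n :: nat where n: "(t - s) / d < real n" using reals_Archimedean2 by blast
    have n0: "real n > 0" using n st that by (smt (verit) divide_pos_pos)
    define p where "p q = s + real q * ((t - s) / real n)" for q :: nat
    have gap: "p (Suc q) - p q = (t - s) / real n" for q
      by (simp add: p_def algebra_simps add_divide_distrib diff_divide_distrib)
    have "(t - s) / real n < d" using n n0 that by (simp add: field_simps)
    moreover have "(t - s) / real n > 0" using st n0 by simp
    moreover have "p q < p (Suc q)" for q using gap[of q] calculation(2) by linarith
    ultimately have "interval_partition s t (n, p) \<and> mesh_less d (n, p)"
      using n0 by (auto simp: interval_partition_def mesh_less_def gap) (simp_all add: p_def)
    then show ?thesis by blast
  qed
  then show ?thesis by (auto simp: trivial_limit_def eventually_mesh_filter)
qed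

lemma has_rough_integral_unique:
  assumes "s \<le> t" "has_rough_integral x m \<mu> s t I" "has_rough_integral x m \<mu> s t J"
  shows "I = J"
  using assms tendsto_unique[OF mesh_filter_not_bot] unfolding has_rough_integral_def by blast

end

theory Submission
  imports Defs
begin

text \<open>
  Write \<open>\<psi> = \<phi>\<inverse>\<close>. Away from \<open>0\<close> one has \<open>\<psi>' = \<sigma> \<circ> \<psi>\<close> and \<open>\<psi>'' = F\<close>; since the right-hand sides
  extend continuously to \<open>0\<close>, l'Hopital's rule shows that \<open>\<psi>\<close> is of class \<open>C\<^sup>2\<close> everywhere.
  The hypothesis on \<open>F\<close> makes \<open>\<psi>''\<close> Hoelder continuous of order \<open>p = (2\<kappa> - 1)/(1 - \<kappa>) \<and> 1\<close>, so the
  second order Taylor expansion of \<open>\<psi>\<close> along \<open>x + \<phi>(a)\<close> has a remainder of order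
  \<open>|t - s| powr (\<gamma> (2 + p))\<close>. As \<open>2 + p\<close> is the minimum of \<open>1/(1 - \<kappa>)\<close> and \<open>3\<close>, the exponent exceeds \<open>1\<close>,
  and the compensated Riemann sums converge to the increment of \<open>\<psi>(x + \<phi>(a))\<close>.
\<close>

section \<open>Hoelder and Taylor estimates on the real line\<close>

text \<open>For exponents in \<open>(0, 1]\<close> the power function is subadditive; apply this to
  \<open>a \<le> \<bar>a - b\<bar> + b\<close> and to the same inequality with \<open>a\<close> and
  \<open>b\<close> exchanged.\<close>

lemma abs_powr_diff_le:
  fixes a b p :: real
  assumes "0 \<le> a" "0 \<le> b" "0 < p" "p \<le> 1"
  shows "\<bar>a powr p - b powr p\<bar> \<le> \<bar>a - b\<bar> powr p"
proof -
  have subadd: "(u + v) powr p \<le> u powr p + v powr p" if "0 \<le> u" "0 \<le> v" for u v :: real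
  proof (cases "u + v = 0")
    case False
    with that have s: "u + v > 0" by linarith
    \<comment> \<open>After division by \<open>u + v\<close> the two terms become weights in
      \<open>[0, 1]\<close> with sum 1, and raising such a weight to the power
      \<open>p \<le> 1\<close> can only increase it.\<close>
    have frac: "w \<le> w powr p" if "0 \<le> w" "w \<le> 1" for w :: real
      using powr_mono'[of p 1 w] assms that by simp
    have "1 = u / (u + v) + v / (u + v)" using s by (simp add: add_divide_distrib[symmetric])
    also have "\<dots> \<le> (u / (u + v)) powr p + (v / (u + v)) powr p"
      using s that by (intro add_mono frac) (auto simp: field_simps)
    also have "\<dots> = (u powr p + v powr p) / (u + v) powr p"
      using s that by (simp add: powr_divide add_divide_distrib)
    finally show ?thesis using s by (simp add: field_simps)
  qed (use that in simp)
  have "a powr p \<le> \<bar>a - b\<bar> powr p + b powr p"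
    using powr_mono2[of p a "\<bar>a - b\<bar> + b"] subadd[of "\<bar>a - b\<bar>" b] assms by linarith
  moreover have "b powr p \<le> \<bar>a - b\<bar> powr p + a powr p"
    using powr_mono2[of p b "\<bar>a - b\<bar> + a"] subadd[of "\<bar>a - b\<bar>" a] assms by linarith
  ultimately show ?thesis by linarith
qed

text \<open>L'Hopital for the difference quotient. It serves at the point 0, where
  \<open>\<sigma>\<close> may vanish or fail to be differentiable and only limits of derivatives are
  available.\<close>

lemma DERIV_at_limit:
  fixes f f' :: "real \<Rightarrow> real"
  assumes "isCont f c" and der: "\<And>u. u \<noteq> c \<Longrightarrow> DERIV f u :> f' u" and lim: "(f' \<longlongrightarrow> L) (at c)"
  shows "DERIV f c :> L"
proof -
  have "((\<lambda>u. (f u - f c) / (u - c)) \<longlongrightarrow> L) (at c)"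
  proof (rule lhopital[where f' = f' and g' = "\<lambda>_. 1"])
    show "((\<lambda>u. f u - f c) \<longlongrightarrow> 0) (at c)"
      using assms(1) by (simp add: isCont_def LIM_zero)
    show "((\<lambda>u. u - c) \<longlongrightarrow> 0) (at c)"
      by (simp add: LIM_zero)
    show "\<forall>\<^sub>F u in at c. u - c \<noteq> 0"
      by (simp add: eventually_at_filter)
    show "\<forall>\<^sub>F u in at c. DERIV (\<lambda>u. f u - f c) u :> f' u"
      unfolding eventually_at_filter
      by (intro always_eventually) (auto intro!: derivative_eq_intros der)
    show "\<forall>\<^sub>F u in at c. DERIV (\<lambda>u. u - c) u :> 1"
      by (intro always_eventually) (auto intro!: derivative_eq_intros)
  qed (use lim in simp_all)
  then show ?thesis by (simp add: has_field_derivative_iff)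
qed

lemma abs_diff_le_of_deriv_bound:
  fixes g g' :: "real \<Rightarrow> real"
  assumes der: "\<And>w. DERIV g w :> g' w" and bd: "\<And>w. \<bar>w - u\<bar> \<le> \<bar>v - u\<bar> \<Longrightarrow> \<bar>g' w\<bar> \<le> B"
  shows "\<bar>g v - g u\<bar> \<le> B * \<bar>v - u\<bar>"
proof -
  have "norm (g v - g u) \<le> B * norm (v - u)"
  proof (rule field_differentiable_bound[where S = "closed_segment u v" and f' = g'])
    fix w assume "w \<in> closed_segment u v"
    then show "norm (g' w) \<le> B"
      using bd by (auto simp: closed_segment_eq_real_ivl split: if_splits)
  qed (auto intro: has_field_derivative_at_within der)
  then show ?thesis by simp
qed

text \<open>Mean value estimate for \<open>f\<close> minus its linear part at \<open>u\<close>,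
  whose derivative is \<open>f' w - f' u\<close>. The factor \<open>1 / (1 + p)\<close> that
  integration would yield is given away.\<close>

lemma taylor_holder_1:
  fixes f f' :: "real \<Rightarrow> real"
  assumes der: "\<And>w. DERIV f w :> f' w" and p: "0 \<le> p"
    and hol: "\<And>v w. \<bar>f' v - f' w\<bar> \<le> K * \<bar>v - w\<bar> powr p" and K: "0 \<le> K"
  shows "\<bar>f v - f u - f' u * (v - u)\<bar> \<le> K * \<bar>v - u\<bar> powr (1 + p)"
proof -
  have "\<bar>(f v - f' u * v) - (f u - f' u * u)\<bar> \<le> K * \<bar>v - u\<bar> powr p * \<bar>v - u\<bar>"
  proof (rule abs_diff_le_of_deriv_bound)
    show "DERIV (\<lambda>v. f v - f' u * v) w :> f' w - f' u" for w
      by (auto intro!: derivative_eq_intros der)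
    fix w assume "\<bar>w - u\<bar> \<le> \<bar>v - u\<bar>"
    then have "\<bar>w - u\<bar> powr p \<le> \<bar>v - u\<bar> powr p" using p by (intro powr_mono2) auto
    then show "\<bar>f' w - f' u\<bar> \<le> K * \<bar>v - u\<bar> powr p"
      using hol[of w u] K by (meson mult_left_mono order_trans)
  qed
  then show ?thesis
    by (cases "v = u") (simp_all add: powr_add algebra_simps)
qed

text \<open>Subtracting the Taylor polynomial at \<open>u\<close> leaves a function whose derivative
  is the first order remainder of \<open>f'\<close>; \<open>taylor_holder_1\<close> bounds that, and
  the mean value estimate adds one power.\<close>

lemma taylor_holder_2:
  fixes f f' f'' :: "real \<Rightarrow> real"
  assumes der: "\<And>w. DERIV f w :> f' w" "\<And>w. DERIV f' w :> f'' w" and p: "0 \<le> p"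
    and hol: "\<And>v w. \<bar>f'' v - f'' w\<bar> \<le> K * \<bar>v - w\<bar> powr p" and K: "0 \<le> K"
  shows "\<bar>f v - f u - f' u * (v - u) - f'' u * ((v - u)\<^sup>2 / 2)\<bar> \<le> K * \<bar>v - u\<bar> powr (2 + p)"
proof -
  let ?g = "\<lambda>v. f v - f' u * (v - u) - f'' u * ((v - u)\<^sup>2 / 2)"
  have "\<bar>?g v - ?g u\<bar> \<le> K * \<bar>v - u\<bar> powr (1 + p) * \<bar>v - u\<bar>"
  proof (rule abs_diff_le_of_deriv_bound)
    show "DERIV ?g w :> f' w - f' u - f'' u * (w - u)" for w
      by (auto intro!: derivative_eq_intros der)
    fix w assume "\<bar>w - u\<bar> \<le> \<bar>v - u\<bar>"
    then have "\<bar>w - u\<bar> powr (1 + p) \<le> \<bar>v - u\<bar> powr (1 + p)" using p by (intro powr_mono2) auto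
    then show "\<bar>f' w - f' u - f'' u * (w - u)\<bar> \<le> K * \<bar>v - u\<bar> powr (1 + p)"
      using taylor_holder_1[OF der(2) p hol K, of w u] K by (meson mult_left_mono order_trans)
  qed
  moreover have "\<bar>v - u\<bar> powr (2 + p) = \<bar>v - u\<bar> powr (1 + p) * \<bar>v - u\<bar>"
    using powr_add[of "\<bar>v - u\<bar>" "1 + p" 1] by (simp add: add_ac)
  ultimately show ?thesis by (simp add: algebra_simps)
qed

section \<open>Rough integrals and controlled paths from local expansions\<close>

text \<open>The candidate \<open>Y\<close> is given, so its increments telescope and the error of a
  compensated sum is the sum of the local errors. Since \<open>\<theta> > 1\<close>, that is at most
  \<open>K * (t - s)\<close> times the mesh to the power \<open>\<theta> - 1\<close>.\<close>

lemma has_rough_integral_of_local_expansion: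
  assumes "1 < \<theta>" "0 \<le> K" "s \<le> t"
    and loc: "\<And>u v. s \<le> u \<Longrightarrow> u \<le> v \<Longrightarrow> v \<le> t \<Longrightarrow>
      \<bar>Y v - Y u - (m u * (x v - x u) + \<mu> u * rough_lift x u v)\<bar> \<le> K * \<bar>v - u\<bar> powr \<theta>"
  shows "has_rough_integral x m \<mu> s t (Y t - Y s)"
  unfolding has_rough_integral_def tendsto_iff eventually_mesh_filter
proof (intro allI impI)
  fix e :: real assume e: "e > 0"
  \<comment> \<open>The summand 1 keeps \<open>M\<close> positive when
    \<open>K * (t - s) = 0\<close> and makes the final estimate strict.\<close>
  define M where "M = K * (t - s) + 1"
  have M: "M > 0" using assms by (simp add: M_def add_nonneg_pos)
  define d where "d = (e / M) powr (1 / (\<theta> - 1))"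
  have d: "d > 0" "d powr (\<theta> - 1) = e / M"
    using e M assms by (simp_all add: d_def powr_powr)
  show "\<exists>d>0. \<forall>P. interval_partition s t P \<and> mesh_less d P \<longrightarrow> dist (rough_sum x m \<mu> P) (Y t - Y s) < e"
  proof (intro exI[of _ d] conjI allI impI)
    fix P assume P: "interval_partition s t P \<and> mesh_less d P"
    obtain n p where np: "P = (n, p)" by fastforce
    have ends: "p 0 = s" "p n = t" and inc: "\<And>q. q < n \<Longrightarrow> p q < p (Suc q)"
      and gap: "\<And>q. q < n \<Longrightarrow> p (Suc q) - p q < d"
      using P by (auto simp: np interval_partition_def mesh_less_def)
    have mono: "p i \<le> p j" if "i \<le> j" "j \<le> n" for i j
      using that
    proof (induction j rule: dec_induct)
      case (step k)
      with inc[of k] show ?case by simp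
    qed simp
    let ?c = "\<lambda>q. m (p q) * (x (p (Suc q)) - x (p q)) + \<mu> (p q) * rough_lift x (p q) (p (Suc q))"
    have step: "\<bar>Y (p (Suc q)) - Y (p q) - ?c q\<bar> \<le> K * (e / M) * (p (Suc q) - p q)"
      if q: "q < n" for q
    proof -
      have "\<bar>Y (p (Suc q)) - Y (p q) - ?c q\<bar> \<le> K * \<bar>p (Suc q) - p q\<bar> powr \<theta>"
        using mono[of 0 q] mono[of q "Suc q"] mono[of "Suc q" n] q ends by (intro loc) auto
      also have "\<dots> = K * ((p (Suc q) - p q) powr (\<theta> - 1) * (p (Suc q) - p q))"
        using inc[OF q] powr_add[of "p (Suc q) - p q" "\<theta> - 1" 1] by simp
      also have "\<dots> \<le> K * (d powr (\<theta> - 1) * (p (Suc q) - p q))"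
        using inc[OF q] gap[OF q] assms
        by (intro mult_left_mono mult_right_mono powr_mono2) auto
      finally show ?thesis by (simp add: d mult_ac)
    qed
    have "Y t - Y s - rough_sum x m \<mu> P = (\<Sum>q<n. Y (p (Suc q)) - Y (p q) - ?c q)"
      using sum_lessThan_telescope[of "\<lambda>q. Y (p q)" n]
      by (simp add: np rough_sum_def sum_subtractf ends)
    also have "\<bar>\<dots>\<bar> \<le> (\<Sum>q<n. K * (e / M) * (p (Suc q) - p q))"
      by (rule order_trans[OF sum_abs sum_mono]) (use step in auto)
    also have "\<dots> = K * (e / M) * (t - s)"
      using sum_lessThan_telescope[of p n] by (simp only: sum_distrib_left[symmetric] ends)
    also have "\<dots> = e * (K * (t - s)) / M" by simp
    also have "\<dots> < e" using e M by (simp add: M_def field_simps)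
    finally show "dist (rough_sum x m \<mu> P) (Y t - Y s) < e" by (simp add: dist_real_def)
  qed (rule d)
qed

lemma holder_on_nonneg:
  assumes "holder_on \<gamma> D f"
  obtains K where "0 \<le> K" "\<And>s t. s \<in> D \<Longrightarrow> t \<in> D \<Longrightarrow> \<bar>f t - f s\<bar> \<le> K * \<bar>t - s\<bar> powr \<gamma>"
proof -
  from assms obtain K where K: "\<And>s t. s \<in> D \<Longrightarrow> t \<in> D \<Longrightarrow> \<bar>f t - f s\<bar> \<le> K * \<bar>t - s\<bar> powr \<gamma>"
    by (auto simp: holder_on_def)
  have "\<bar>f t - f s\<bar> \<le> \<bar>K\<bar> * \<bar>t - s\<bar> powr \<gamma>" if "s \<in> D" "t \<in> D" for s t
    using K[OF that] by (meson abs_ge_self mult_right_mono order_trans powr_ge_zero)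
  then show thesis by (intro that[of "\<bar>K\<bar>"]) auto
qed

text \<open>Taylor remainders of \<open>S\<close> and \<open>\<psi>\<close>, of orders
  \<open>1 + p\<close> and \<open>2 + p\<close> in the increment of \<open>x\<close>, become orders
  \<open>\<gamma> * (1 + p)\<close> and \<open>\<gamma> * (2 + p)\<close> in time. The first is the
  controlled remainder, the second the local error of the Riemann sums.\<close>

lemma controlled_image_of_C2:
  fixes \<psi> S F x :: "real \<Rightarrow> real"
  assumes "0 < \<gamma>" "0 < p" "1 < \<gamma> * (2 + p)" "0 \<le> K" "0 \<le> T"
    and x: "holder_on \<gamma> {0..T} x"
    and der: "\<And>w. DERIV \<psi> w :> S w" "\<And>w. DERIV S w :> F w"
    and hol: "\<And>v w. \<bar>F v - F w\<bar> \<le> K * \<bar>v - w\<bar> powr p"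
  shows "weakly_controlled T \<gamma> (\<gamma> * (1 + p)) x (\<lambda>s. S (x s)) (\<lambda>s. F (x s))"
    and "\<And>t. t \<in> {0..T} \<Longrightarrow>
      has_rough_integral x (\<lambda>s. S (x s)) (\<lambda>s. F (x s)) 0 t (\<psi> (x t) - \<psi> (x 0))"
proof -
  obtain H where H: "0 \<le> H"
    "\<And>s t. s \<in> {0..T} \<Longrightarrow> t \<in> {0..T} \<Longrightarrow> \<bar>x t - x s\<bar> \<le> H * \<bar>t - s\<bar> powr \<gamma>"
    using holder_on_nonneg[OF x] by metis
  have Hp: "K * \<bar>x t - x s\<bar> powr q \<le> K * H powr q * \<bar>t - s\<bar> powr (\<gamma> * q)"
    if "s \<in> {0..T}" "t \<in> {0..T}" "0 \<le> q" for s t q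
  proof -
    have "\<bar>x t - x s\<bar> powr q \<le> (H * \<bar>t - s\<bar> powr \<gamma>) powr q"
      using H(2)[OF that(1,2)] that(3) by (intro powr_mono2) auto
    then have "\<bar>x t - x s\<bar> powr q \<le> H powr q * \<bar>t - s\<bar> powr (\<gamma> * q)"
      using H(1) by (simp add: powr_mult powr_powr)
    from mult_left_mono[OF this \<open>0 \<le> K\<close>] show ?thesis by (simp add: mult.assoc)
  qed
  have F: "\<bar>F (x t) - F (x s)\<bar> \<le> K * H powr p * \<bar>t - s\<bar> powr (\<gamma> * p)"
    if "s \<in> {0..T}" "t \<in> {0..T}" for s t
    using hol[of "x t" "x s"] Hp[OF that, of p] assms by linarith
  have rem: "\<bar>S (x t) - S (x s) - F (x s) * (x t - x s)\<bar> \<le> K * H powr (1 + p) * \<bar>t - s\<bar> powr (\<gamma> * (1 + p))"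
    if "s \<in> {0..T}" "t \<in> {0..T}" for s t
    using taylor_holder_1[OF der(2) _ hol, of "x t" "x s"] Hp[OF that, of "1 + p"] assms by linarith
  obtain B where B: "\<And>t. t \<in> {0..T} \<Longrightarrow> \<bar>F (x t)\<bar> \<le> B"
  proof
    fix t assume t: "t \<in> {0..T}"
    have "\<bar>t\<bar> powr (\<gamma> * p) \<le> T powr (\<gamma> * p)"
      using t assms by (intro powr_mono2) auto
    then have "K * H powr p * \<bar>t\<bar> powr (\<gamma> * p) \<le> K * H powr p * T powr (\<gamma> * p)"
      using assms by (intro mult_left_mono) auto
    then show "\<bar>F (x t)\<bar> \<le> \<bar>F (x 0)\<bar> + K * H powr p * T powr (\<gamma> * p)"
      using F[of 0 t] t by auto
  qed
  have "holder_on \<gamma> {0..T} (\<lambda>s. S (x s))"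
    unfolding holder_on_def
  proof (intro exI ballI)
    fix s t assume st: "s \<in> {0..T}" "t \<in> {0..T}"
    \<comment> \<open>On \<open>[0, T]\<close> the surplus order \<open>\<gamma> * p\<close> is
      absorbed into a constant.\<close>
    have "\<bar>t - s\<bar> powr (\<gamma> * (1 + p)) = \<bar>t - s\<bar> powr (\<gamma> * p) * \<bar>t - s\<bar> powr \<gamma>"
      by (simp add: powr_add[symmetric] algebra_simps)
    also have "\<dots> \<le> T powr (\<gamma> * p) * \<bar>t - s\<bar> powr \<gamma>"
      using st assms by (intro mult_right_mono powr_mono2) auto
    finally have "K * H powr (1 + p) * \<bar>t - s\<bar> powr (\<gamma> * (1 + p))
        \<le> K * H powr (1 + p) * (T powr (\<gamma> * p) * \<bar>t - s\<bar> powr \<gamma>)"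
      using assms by (intro mult_left_mono) auto
    moreover have "\<bar>F (x s) * (x t - x s)\<bar> \<le> B * (H * \<bar>t - s\<bar> powr \<gamma>)"
      unfolding abs_mult using B[OF st(1)] H(2)[OF st] by (intro mult_mono) auto
    ultimately show "\<bar>S (x t) - S (x s)\<bar>
        \<le> (K * H powr (1 + p) * T powr (\<gamma> * p) + B * H) * \<bar>t - s\<bar> powr \<gamma>"
      using rem[OF st] by (simp add: algebra_simps)
  qed
  moreover have "holder_on (\<gamma> * p) {0..T} (\<lambda>s. F (x s))"
    using F unfolding holder_on_def by blast
  moreover have "bounded ((\<lambda>s. F (x s)) ` {0..T})"
    using B unfolding bounded_iff by (intro exI[of _ B]) auto
  moreover have "\<gamma> < \<gamma> * (1 + p)" "\<gamma> * (1 + p) - \<gamma> = \<gamma> * p"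
    using assms by (simp_all add: algebra_simps)
  moreover have "bdd_above {\<bar>S (x t) - S (x s) - F (x s) * (x t - x s)\<bar> / \<bar>t - s\<bar> powr (\<gamma> * (1 + p))
      | s t. 0 \<le> s \<and> s < t \<and> t \<le> T}"
  proof (rule bdd_aboveI[where M = "K * H powr (1 + p)"], clarify)
    fix s t :: real assume "0 \<le> s" "s < t" "t \<le> T"
    with rem[of s t] show "\<bar>S (x t) - S (x s) - F (x s) * (x t - x s)\<bar> / \<bar>t - s\<bar> powr (\<gamma> * (1 + p))
        \<le> K * H powr (1 + p)"
      by (simp add: divide_le_eq)
  qed
  ultimately show "weakly_controlled T \<gamma> (\<gamma> * (1 + p)) x (\<lambda>s. S (x s)) (\<lambda>s. F (x s))"
    unfolding weakly_controlled_def
    by (intro conjI exI[of _ "\<lambda>s t. S (x t) - S (x s) - F (x s) * (x t - x s)"]) simp_all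
  fix t assume t: "t \<in> {0..T}"
  show "has_rough_integral x (\<lambda>s. S (x s)) (\<lambda>s. F (x s)) 0 t (\<psi> (x t) - \<psi> (x 0))"
  proof (rule has_rough_integral_of_local_expansion[where Y = "\<lambda>s. \<psi> (x s)"
        and \<theta> = "\<gamma> * (2 + p)" and K = "K * H powr (2 + p)"])
    fix u v assume "0 \<le> u" "u \<le> v" "v \<le> t"
    with t have "u \<in> {0..T}" "v \<in> {0..T}" by auto
    from Hp[OF this, of "2 + p"] taylor_holder_2[OF der _ hol, of "x v" "x u"] assms
    show "\<bar>\<psi> (x v) - \<psi> (x u) - (S (x u) * (x v - x u) + F (x u) * rough_lift x u v)\<bar>
        \<le> K * H powr (2 + p) * \<bar>v - u\<bar> powr (\<gamma> * (2 + p))"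
      by (simp add: rough_lift_def algebra_simps)
  qed (use assms t in auto)
qed

section \<open>Regularity and monotonicity of \<open>phi\<close>\<close>

text \<open>Passes from the signed Lebesgue integral to the gauge integral over
  \<open>[a, b]\<close>, for which continuity and the fundamental theorem of calculus are applied
  below.\<close>

lemma phi_diff_eq_integral:
  assumes int: "\<forall>\<xi>::real. interval_lebesgue_integrable lborel 0 \<xi> (\<lambda>s. 1 / \<sigma> s)" and "a \<le> b"
  shows "(\<lambda>s. 1 / \<sigma> s) integrable_on {a..b}"
    and "phi \<sigma> b - phi \<sigma> a = integral {a..b} (\<lambda>s. 1 / \<sigma> s)"
proof -
  let ?f = "\<lambda>s. 1 / \<sigma> s"
  \<comment> \<open>Interval integrability refers to the open interval; the endpoints form a null
    set.\<close>
  have Icc: "interval_lebesgue_integrable lborel (ereal u) (ereal v) ?f \<longleftrightarrow> set_integrable lborel {u..v} ?f"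
    if "u \<le> v" for u v
  proof -
    have "set_integrable lborel {u<..<v} ?f \<longleftrightarrow> set_integrable lborel {u..v} ?f"
      by (rule set_integrable_discrete_difference[of "{u, v}"]) auto
    with that show ?thesis by (simp add: interval_lebesgue_integrable_def)
  qed
  have pos: "set_integrable lborel {0..N} ?f" and neg: "set_integrable lborel {-N..0} ?f"
    if "0 \<le> N" for N
    using int[rule_format, of N] int[rule_format, of "-N"] that
      interval_integrable_endpoints_reverse[of 0 "ereal (-N)" ?f] Icc[of 0 N] Icc[of "-N" 0]
    unfolding zero_ereal_def by simp_all
  have sub: "set_integrable lborel {u..v} ?f" for u v
  proof -
    define N where "N = max \<bar>u\<bar> \<bar>v\<bar>"
    have "set_integrable lborel ({-N..0} \<union> {0..N}) ?f"
      by (intro set_integrable_Un pos neg) (auto simp: N_def)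
    then show ?thesis
      by (rule set_integrable_subset) (auto simp: N_def)
  qed
  from set_borel_integral_eq_integral[OF sub] show "?f integrable_on {a..b}" by blast
  \<comment> \<open>\<open>interval_integral_sum\<close> wants integrability over the hull of the
    three endpoints, formed in \<open>ereal\<close>.\<close>
  have "min 0 (min (ereal a) (ereal b)) = ereal (min 0 (min a b))"
    "max 0 (max (ereal a) (ereal b)) = ereal (max 0 (max a b))"
    by (simp_all add: min_def max_def zero_ereal_def)
  then have "(LBINT s=0..a. ?f s) + (LBINT s=a..b. ?f s) = (LBINT s=0..b. ?f s)"
    using sub Icc[of "min 0 (min a b)" "max 0 (max a b)"] by (intro interval_integral_sum) auto
  then show "phi \<sigma> b - phi \<sigma> a = integral {a..b} ?f"
    using interval_integral_eq_integral[OF \<open>a \<le> b\<close> sub] by (simp add: phi_def)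
qed

lemma continuous_on_phi:
  assumes int: "\<forall>\<xi>::real. interval_lebesgue_integrable lborel 0 \<xi> (\<lambda>s. 1 / \<sigma> s)"
  shows "continuous_on UNIV (phi \<sigma>)"
proof -
  have "isCont (phi \<sigma>) u" for u
  proof -
    have eq: "phi \<sigma> v = phi \<sigma> (u-1) + integral {u-1..v} (\<lambda>s. 1 / \<sigma> s)" if "v \<in> {u-1..u+1}" for v
      using phi_diff_eq_integral(2)[OF int, of "u-1" v] that by simp
    have "continuous_on {u-1..u+1} (\<lambda>v. phi \<sigma> (u-1) + integral {u-1..v} (\<lambda>s. 1 / \<sigma> s))"
      using phi_diff_eq_integral(1)[OF int, of "u-1" "u+1"]
      by (intro continuous_intros indefinite_integral_continuous_1) auto
    also have "?this \<longleftrightarrow> continuous_on {u-1..u+1} (phi \<sigma>)"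
      by (rule continuous_on_cong[OF refl eq[symmetric]])
    finally show ?thesis by (rule continuous_on_interior) auto
  qed
  then show ?thesis by (simp add: continuous_on_eq_continuous_at)
qed

lemma DERIV_phi:
  assumes int: "\<forall>\<xi>::real. interval_lebesgue_integrable lborel 0 \<xi> (\<lambda>s. 1 / \<sigma> s)"
    and cont: "continuous_on UNIV \<sigma>" and nz: "\<sigma> u \<noteq> 0"
  shows "DERIV (phi \<sigma>) u :> 1 / \<sigma> u"
proof -
  have "isCont \<sigma> u" using cont by (simp add: continuous_on_eq_continuous_at)
  from continuous_at_avoid[OF this nz] obtain d where d: "d > 0" "\<And>v. dist u v < d \<Longrightarrow> \<sigma> v \<noteq> 0"
    by auto
  define e where "e = d / 2"
  have e: "e > 0" "\<And>v. v \<in> {u-e..u+e} \<Longrightarrow> \<sigma> v \<noteq> 0"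
    using d by (auto simp: e_def dist_real_def)
  have eq: "integral {u-e..v} (\<lambda>s. 1 / \<sigma> s) = phi \<sigma> v - phi \<sigma> (u-e)" if "v \<in> {u-e..u+e}" for v
    using phi_diff_eq_integral(2)[OF int, of "u-e" v] that by simp
  have "((\<lambda>v. integral {u-e..v} (\<lambda>s. 1 / \<sigma> s)) has_real_derivative 1 / \<sigma> u) (at u within {u-e..u+e})"
    using e by (intro integral_has_real_derivative continuous_intros continuous_on_subset[OF cont]) auto
  then have "((\<lambda>v. phi \<sigma> v - phi \<sigma> (u-e)) has_real_derivative 1 / \<sigma> u) (at u within {u-e..u+e})"
    by (rule has_field_derivative_transform_within[where d = 1]) (use eq e in auto)
  then have "((\<lambda>v. phi \<sigma> v - phi \<sigma> (u-e) + phi \<sigma> (u-e)) has_real_derivative 1 / \<sigma> u + 0)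
      (at u within {u-e..u+e})"
    by (intro DERIV_add DERIV_const)
  moreover have "u \<in> interior {u-e..u+e}" using e by simp
  ultimately show ?thesis by (simp only: at_within_interior diff_add_cancel add_0_right)
qed

text \<open>A continuous injection of the line is strictly monotone; the positive integrand on
  \<open>[1, 2]\<close> rules out the decreasing case.\<close>

lemma strict_mono_phi:
  assumes int: "\<forall>\<xi>::real. interval_lebesgue_integrable lborel 0 \<xi> (\<lambda>s. 1 / \<sigma> s)"
    and cont: "continuous_on UNIV \<sigma>" and pos: "\<forall>\<xi>>0. \<sigma> \<xi> > 0" and "inj (phi \<sigma>)"
  shows "strict_mono (phi \<sigma>)"
proof -
  have "strict_mono_on UNIV (phi \<sigma>) \<or> strict_antimono_on UNIV (phi \<sigma>)"
    using injective_eq_monotone_map[of UNIV "phi \<sigma>"] assms continuous_on_phi[OF int] by simp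
  moreover have "\<not> strict_antimono_on UNIV (phi \<sigma>)"
  proof
    assume "strict_antimono_on UNIV (phi \<sigma>)"
    then have "phi \<sigma> 2 < phi \<sigma> 1" by (auto simp: monotone_on_def)
    moreover have "0 \<le> integral {1..2} (\<lambda>s. 1 / \<sigma> s)"
      using phi_diff_eq_integral(1)[OF int, of 1 2] pos
      by (intro integral_nonneg) (auto intro: less_imp_le)
    ultimately show False using phi_diff_eq_integral(2)[OF int, of 1 2] by simp
  qed
  ultimately show ?thesis by blast
qed

section \<open>Positivity of \<open>\<sigma>\<close> off 0 and regularity of the inverse of
  \<open>phi\<close>\<close>

text \<open>Positivity on the negative axis has to be derived. A negative value would make
  \<open>phi\<close> decrease locally, and near a zero at \<open>z < 0\<close> the \<open>C1\<close>
  function \<open>\<sigma>\<close> would be too small for \<open>1 / \<sigma>\<close> to be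
  integrable.\<close>

lemma sigma_pos:
  assumes int: "\<forall>\<xi>::real. interval_lebesgue_integrable lborel 0 \<xi> (\<lambda>s. 1 / \<sigma> s)"
    and cont: "continuous_on UNIV \<sigma>" and C1: "\<sigma> C1_differentiable_on (- {0})"
    and pos: "\<forall>\<xi>>0. \<sigma> \<xi> > 0" and "inj (phi \<sigma>)" and "z \<noteq> 0"
  shows "\<sigma> z > 0"
proof -
  note mono = strict_mono_phi[OF int cont pos \<open>inj (phi \<sigma>)\<close>]
  note contphi = continuous_on_phi[OF int]
  have nonneg: "\<sigma> u \<ge> 0" for u
  proof (rule ccontr)
    assume "\<not> \<sigma> u \<ge> 0"
    then have "DERIV (phi \<sigma>) u :> 1 / \<sigma> u" "1 / \<sigma> u < 0"
      using DERIV_phi[OF int cont, of u] by auto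
    from DERIV_neg_dec_right[OF this] obtain d where
      "d > 0" "\<And>h. h > 0 \<Longrightarrow> h < d \<Longrightarrow> phi \<sigma> (u + h) < phi \<sigma> u" by auto
    then have "phi \<sigma> (u + d / 2) < phi \<sigma> u" by simp
    with mono \<open>d > 0\<close> show False by (simp add: strict_mono_less)
  qed
  have "\<sigma> z \<noteq> 0"
  proof
    assume z0: "\<sigma> z = 0"
    with pos \<open>z \<noteq> 0\<close> have "z < 0" by (metis linorder_neqE_linordered_idom order_less_irrefl)
    \<comment> \<open>With \<open>1 / 0 = 0\<close>, \<open>\<phi>\<close> would be constant on an interval of zeros of \<open>\<sigma>\<close>.\<close>
    obtain u where u: "z < u" "u < 0" "\<sigma> u \<noteq> 0"
    proof (rule ccontr)
      assume "\<not> thesis"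
      with that have "\<sigma> v = 0" if "v \<in> {z..z/2}" for v
        using that z0 \<open>z < 0\<close> by (cases "v = z") force+
      then have "integral {z..z/2} (\<lambda>s. 1 / \<sigma> s) = integral {z..z/2} (\<lambda>s. 0)"
        by (intro integral_cong) auto
      then have "phi \<sigma> z = phi \<sigma> (z/2)"
        using phi_diff_eq_integral(2)[OF int, of z "z/2"] \<open>z < 0\<close> by simp
      from injD[OF \<open>inj (phi \<sigma>)\<close> this] \<open>z < 0\<close> show False by simp
    qed
    \<comment> \<open>The last zero \<open>w\<close> before \<open>u\<close> makes
      \<open>\<sigma>\<close> positive on all of \<open>(w, u]\<close>.\<close>
    define Z where "Z = {v \<in> {z..u}. \<sigma> v = 0}"
    have "closed Z"
      unfolding Z_def
      using continuous_closed_preimage_constant[OF continuous_on_subset[OF cont], of "{z..u}" 0]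
      by simp
    then have "compact Z"
      unfolding Z_def
      by (metis (no_types, lifting) bounded_closed_interval bounded_subset compact_eq_bounded_closed mem_Collect_eq subsetI)
    moreover have "z \<in> Z" using z0 u by (simp add: Z_def)
    ultimately obtain w where w: "w \<in> Z" "\<And>v. v \<in> Z \<Longrightarrow> v \<le> w"
      using compact_attains_sup[of Z] by blast
    have wu: "z \<le> w" "w < u" "\<sigma> w = 0" using w(1) u by (auto simp: Z_def less_le)
    have nz: "\<sigma> v > 0" if "w < v" "v \<le> u" for v
      using w(2)[of v] nonneg[of v] that wu by (auto simp: Z_def less_le)
    obtain D where D: "\<And>v. v \<noteq> 0 \<Longrightarrow> DERIV \<sigma> v :> D v" "continuous_on (-{0}) D"
      using C1 by (auto simp: C1_differentiable_on_def has_real_derivative_iff_has_vector_derivative)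
    \<comment> \<open>As \<open>u < 0\<close>, the interval avoids 0, where \<open>D\<close> need
      not be continuous.\<close>
    have "compact (D ` {w..u})"
      using u by (intro compact_continuous_image continuous_on_subset[OF D(2)]) auto
    then obtain K where K: "\<And>v. v \<in> {w..u} \<Longrightarrow> D v \<le> K"
      by (metis (no_types, lifting) abs_le_D1 bounded_real compact_imp_bounded imageI)
    \<comment> \<open>A Gronwall argument in the clock \<open>\<phi>\<close>: on \<open>(w, u]\<close> the bound \<open>\<sigma>' \<le> K\<close> gives \<open>d\<sigma> \<le> K \<sigma> d\<phi>\<close>, and \<open>\<phi>\<close> stays
      bounded at \<open>w\<close>, so \<open>\<sigma>\<close> cannot tend to \<open>0\<close> there.\<close>
    define W where "W = (\<lambda>v. \<sigma> v * exp (- K * phi \<sigma> v))"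
    have "W u \<le> W w"
    proof (rule DERIV_nonpos_imp_decreasing_open[where f = W and a = w and b = u])
      show "continuous_on {w..u} W"
        unfolding W_def
        by (intro continuous_intros continuous_on_subset[OF cont] continuous_on_subset[OF contphi]) auto
      fix v assume v: "w < v" "v < u"
      then have "\<sigma> v > 0" using nz by simp
      moreover have "DERIV W v :> D v * exp (- K * phi \<sigma> v)
          + exp (- K * phi \<sigma> v) * (- K * (1 / \<sigma> v)) * \<sigma> v"
        unfolding W_def using v u \<open>\<sigma> v > 0\<close>
        by (intro DERIV_mult D DERIV_fun_exp DERIV_cmult DERIV_phi[OF int cont]) auto
      ultimately have "DERIV W v :> (D v - K) * exp (- K * phi \<sigma> v)"
        by (simp add: algebra_simps)
      then show "\<exists>y. DERIV W v :> y \<and> y \<le> 0"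
        using K[of v] v by (intro exI conjI) (auto intro: mult_nonpos_nonneg)
    qed (use wu in simp)
    moreover have "W w = 0" "W u > 0" using nz[of u] wu by (simp_all add: W_def)
    ultimately show False by simp
  qed
  with nonneg[of z] show ?thesis by simp
qed

text \<open>Off 0 these are the inverse function rule and the chain rule; at 0 both follow from
  \<open>DERIV_at_limit\<close>.\<close>

lemma inv_phi_C2:
  assumes int: "\<forall>\<xi>::real. interval_lebesgue_integrable lborel 0 \<xi> (\<lambda>s. 1 / \<sigma> s)"
    and cont: "continuous_on UNIV \<sigma>" and C1: "\<sigma> C1_differentiable_on (- {0})"
    and pos: "\<forall>\<xi>>0. \<sigma> \<xi> > 0" and bij: "bij (phi \<sigma>)"
    and lim: "\<exists>L. ((\<lambda>u. deriv \<sigma> u * \<sigma> u) \<longlongrightarrow> L) (at 0)"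
  shows "DERIV (inv (phi \<sigma>)) \<xi> :> \<sigma> (inv (phi \<sigma>) \<xi>)"
    and "DERIV (\<lambda>\<xi>. \<sigma> (inv (phi \<sigma>) \<xi>)) \<xi> :> Dsigma_sigma \<sigma> (inv (phi \<sigma>) \<xi>)"
proof -
  define \<psi> where "\<psi> = inv (phi \<sigma>)"
  have inj: "inj (phi \<sigma>)" and surj: "surj (phi \<sigma>)" using bij by (auto simp: bij_def)
  note mono = strict_mono_phi[OF int cont pos inj]
  have phi_psi: "phi \<sigma> (\<psi> \<xi>) = \<xi>" for \<xi> by (simp add: \<psi>_def surj_f_inv_f[OF surj])
  have phi0: "phi \<sigma> 0 = 0" by (simp add: phi_def zero_ereal_def)
  \<comment> \<open>The exceptional point of \<open>\<sigma>\<close> is thus met only at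
    \<open>\<xi> = 0\<close>.\<close>
  have psi0: "\<psi> \<xi> = 0 \<longleftrightarrow> \<xi> = 0" for \<xi> using phi_psi[of \<xi>] phi0 inj by (metis injD)
  have "continuous_on UNIV \<psi>"
  proof (rule continuous_onI_mono)
    have "range \<psi> = UNIV" using bij by (simp add: \<psi>_def bij_imp_bij_inv bij_is_surj)
    then show "open (range \<psi>)" by simp
    show "\<psi> u \<le> \<psi> v" if "u \<le> v" for u v
      using that mono phi_psi by (metis strict_mono_less_eq)
  qed
  then have cpsi: "isCont \<psi> \<xi>" for \<xi> by (simp add: continuous_on_eq_continuous_at)
  have csig: "isCont \<sigma> u" for u using cont by (simp add: continuous_on_eq_continuous_at)
  have cS: "isCont (\<lambda>\<xi>. \<sigma> (\<psi> \<xi>)) \<xi>" for \<xi> using cpsi csig by (rule isCont_o2)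
  have d1: "DERIV \<psi> \<xi> :> \<sigma> (\<psi> \<xi>)" if "\<xi> \<noteq> 0" for \<xi>
  proof -
    have "\<sigma> (\<psi> \<xi>) > 0" using sigma_pos[OF int cont C1 pos inj] psi0 that by blast
    then show ?thesis
      using DERIV_inverse_function[where f = "phi \<sigma>" and g = \<psi> and x = \<xi>
            and D = "1 / \<sigma> (\<psi> \<xi>)" and a = "\<xi> - 1" and b = "\<xi> + 1"]
        DERIV_phi[OF int cont, of "\<psi> \<xi>"] phi_psi cpsi by simp
  qed
  have d1': "DERIV \<psi> \<xi> :> \<sigma> (\<psi> \<xi>)" for \<xi>
  proof (cases "\<xi> = 0")
    case True
    show ?thesis unfolding True
      by (rule DERIV_at_limit[OF cpsi d1]) (use cS[of 0] in \<open>auto simp: isCont_def\<close>)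
  qed (rule d1)
  obtain D where D: "\<And>v. v \<noteq> 0 \<Longrightarrow> DERIV \<sigma> v :> D v"
    using C1 by (auto simp: C1_differentiable_on_def has_real_derivative_iff_has_vector_derivative)
  have d2: "DERIV (\<lambda>\<xi>. \<sigma> (\<psi> \<xi>)) \<xi> :> Dsigma_sigma \<sigma> (\<psi> \<xi>)" if "\<xi> \<noteq> 0" for \<xi>
  proof -
    have "\<psi> \<xi> \<noteq> 0" using that psi0 by simp
    then have "Dsigma_sigma \<sigma> (\<psi> \<xi>) = D (\<psi> \<xi>) * \<sigma> (\<psi> \<xi>)"
      using DERIV_imp_deriv[OF D] by (simp add: Dsigma_sigma_def)
    then show ?thesis using DERIV_chain2[OF D[OF \<open>\<psi> \<xi> \<noteq> 0\<close>] d1'] by simp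
  qed
  from lim obtain L where L: "((\<lambda>u. deriv \<sigma> u * \<sigma> u) \<longlongrightarrow> L) (at 0)" by blast
  then have "Lim (at 0) (\<lambda>u. deriv \<sigma> u * \<sigma> u) = L" by (intro tendsto_Lim) auto
  then have DsL: "Dsigma_sigma \<sigma> (\<psi> 0) = L" using psi0[of 0] by (simp add: Dsigma_sigma_def)
  \<comment> \<open>\<open>L\<close> is a limit over punctured neighbourhoods, so composing with
    \<open>\<psi>\<close> requires that \<open>\<psi>\<close> avoid 0 off 0.\<close>
  have "filterlim \<psi> (at 0) (at 0)"
  proof (rule filterlim_atI)
    have "\<psi> 0 = 0" using psi0 by blast
    with cpsi[of 0] show "(\<psi> \<longlongrightarrow> 0) (at 0)" unfolding isCont_def by simp
  qed (simp add: eventually_at_filter psi0)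
  from filterlim_compose[OF L this]
  have "((\<lambda>\<xi>. Dsigma_sigma \<sigma> (\<psi> \<xi>)) \<longlongrightarrow> L) (at 0)"
    by (rule Lim_transform_eventually) (auto simp: eventually_at_filter psi0 Dsigma_sigma_def)
  from DERIV_at_limit[OF cS d2 this]
  have "DERIV (\<lambda>\<xi>. \<sigma> (\<psi> \<xi>)) \<xi> :> Dsigma_sigma \<sigma> (\<psi> \<xi>)" for \<xi>
    using d2 DsL by (cases "\<xi> = 0") auto
  with d1' show "DERIV (inv (phi \<sigma>)) \<xi> :> \<sigma> (inv (phi \<sigma>) \<xi>)"
    "DERIV (\<lambda>\<xi>. \<sigma> (inv (phi \<sigma>) \<xi>)) \<xi> :> Dsigma_sigma \<sigma> (inv (phi \<sigma>) \<xi>)"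
    by (simp_all add: \<psi>_def)
qed

section \<open>Exponent arithmetic and the shift by \<open>phi \<sigma> a\<close>\<close>

theorem theorem3p6:
  fixes T \<gamma> \<kappa> a C :: real and x \<sigma> :: "real \<Rightarrow> real"
  assumes "T > 0"
    and "1 / 3 < \<gamma>" and "\<gamma> \<le> 1 / 2"
    and "0 < \<kappa>" and "\<kappa> < 1" and "\<kappa> + \<gamma> > 1"
    and "holder_on \<gamma> {0..T} x" and "x 0 = 0"
    and "continuous_on UNIV \<sigma>"
    and "\<sigma> C1_differentiable_on (- {0})"
    and "\<exists>L. ((\<lambda>u. deriv \<sigma> u * \<sigma> u) \<longlongrightarrow> L) (at 0)"
    and "\<forall>\<xi>>0. \<sigma> \<xi> > 0"
    and "\<forall>\<xi>::real. interval_lebesgue_integrable lborel 0 \<xi> (\<lambda>s. 1 / \<sigma> s)"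
    and "bij (phi \<sigma>)"
    and "\<forall>\<xi>1 \<xi>2 :: real.
      \<bar>Dsigma_sigma \<sigma> (inv (phi \<sigma>) \<xi>1) - Dsigma_sigma \<sigma> (inv (phi \<sigma>) \<xi>2)\<bar>
        \<le> C * \<bar>\<bar>\<xi>1\<bar> powr (min ((2 * \<kappa> - 1) / (1 - \<kappa>)) 1)
               - \<bar>\<xi>2\<bar> powr (min ((2 * \<kappa> - 1) / (1 - \<kappa>)) 1)\<bar>"
  shows "solves_rde T \<gamma> x \<sigma> a (\<lambda>t. inv (phi \<sigma>) (x t + phi \<sigma> a))"
proof -
  define p where "p = min ((2 * \<kappa> - 1) / (1 - \<kappa>)) 1"
  define \<psi> where "\<psi> = inv (phi \<sigma>)"
  define S where "S = (\<lambda>\<xi>. \<sigma> (\<psi> \<xi>))"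
  define F where "F = (\<lambda>\<xi>. Dsigma_sigma \<sigma> (\<psi> \<xi>))"
  define z where "z = (\<lambda>t. x t + phi \<sigma> a)"
  \<comment> \<open>\<open>\<gamma> \<le> 1 / 2\<close> and \<open>\<kappa> + \<gamma> > 1\<close>
    force \<open>\<kappa> > 1 / 2\<close>.\<close>
  have p: "0 < p" "p \<le> 1" using assms(3-6) by (simp_all add: p_def)
  \<comment> \<open>For \<open>p = 1\<close> this is \<open>\<gamma> > 1 / 3\<close>; otherwise it
    is \<open>\<gamma> > 1 - \<kappa>\<close>.\<close>
  have order: "1 < \<gamma> * (2 + p)"
  proof (cases "p = 1")
    case False
    then have eq: "2 + p = 1 / (1 - \<kappa>)"
      using assms(5) by (simp add: p_def min_def field_simps split: if_splits)
    show ?thesis unfolding eq using assms(5,6) by (simp add: field_simps)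
  qed (use assms(2) in simp)
  have der: "DERIV \<psi> w :> S w" "DERIV S w :> F w" for w
    unfolding \<psi>_def S_def F_def by (rule inv_phi_C2; fact)+
  \<comment> \<open>\<open>\<bar>C\<bar>\<close> appears because the sign of \<open>C\<close> is not
    prescribed.\<close>
  have hol: "\<bar>F v - F w\<bar> \<le> \<bar>C\<bar> * \<bar>v - w\<bar> powr p" for v w
  proof -
    have "\<bar>F v - F w\<bar> \<le> C * \<bar>\<bar>v\<bar> powr p - \<bar>w\<bar> powr p\<bar>"
      using assms(15) by (simp add: F_def \<psi>_def p_def)
    also have "\<dots> \<le> \<bar>C\<bar> * \<bar>\<bar>v\<bar> - \<bar>w\<bar>\<bar> powr p"
      using p by (intro mult_mono abs_powr_diff_le) auto
    also have "\<dots> \<le> \<bar>C\<bar> * \<bar>v - w\<bar> powr p"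
      using p by (intro mult_left_mono powr_mono2) auto
    finally show ?thesis .
  qed
  have z: "holder_on \<gamma> {0..T} z" using assms(7) by (simp add: holder_on_def z_def)
  have \<gamma>: "0 < \<gamma>" and T: "0 \<le> T" using assms(1,2) by simp_all
  have za: "\<psi> (z 0) = a" using assms(8,14) by (simp add: z_def \<psi>_def bij_is_inj)
  note ctl = controlled_image_of_C2[OF \<gamma> p(1) order abs_ge_zero T z der hol]
  \<comment> \<open>The driver enters the controlled expansion and the sums only through increments,
    so \<open>z\<close> may be replaced by \<open>x\<close> there.\<close>
  have inc: "z v - z u = x v - x u" for u v by (simp add: z_def)
  have "weakly_controlled T \<gamma> (\<gamma> * (1 + p)) x (\<lambda>s. S (z s)) (\<lambda>s. F (z s))"
    using ctl(1) by (simp add: weakly_controlled_def inc)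
  moreover have "has_rough_integral x (\<lambda>s. S (z s)) (\<lambda>s. F (z s)) 0 t (\<psi> (z t) - a)"
    if "t \<in> {0..T}" for t
    using ctl(2)[OF that] by (simp add: has_rough_integral_def rough_sum_def rough_lift_def inc za)
  \<comment> \<open>The condition \<open>\<eta> + \<gamma> > 1\<close> is the inequality
    \<open>order\<close> rearranged.\<close>
  moreover have "\<gamma> * (1 + p) + \<gamma> > 1" using order by (simp add: algebra_simps)
  moreover have "\<psi> (z t) = a + (\<psi> (z t) - a)" for t by simp
  ultimately have "solves_rde T \<gamma> x \<sigma> a (\<lambda>t. \<psi> (z t))"
    unfolding solves_rde_def S_def F_def by blast
  then show ?thesis by (simp add: \<psi>_def z_def)
qed

end
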